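(* Let $\mathcal{X}$ be a finite state space, $\pi$ a probability mass function on $\mathcal{X}$ with full support, and $m\in\mathbb{N}$, $m\ge1$. Let $P \in \mathcal{L}(\pi)$ and let $Q_0,\ldots,Q_{m-1} \in \mathcal{I}(\pi) \cap \mathcal{L}$. Define $R_0:=P$ and $R_n := \overline{R_{n-1}}(Q_{(n-1) \bmod m})$ for $n\ge1$, and let $R_\infty$ be the unique minimizer of $N\mapsto D^\pi_{KL}(P\|N)$ over $N\in\bigcap_{k=0}^{m-1}\mathcal{L}(\pi,Q_k)$. For $i\in\{0,\ldots,m-2\}$ put $$\alpha_i := \alpha\Big(\mathcal{M}(\pi,Q_i),\ \bigcap_{j=i+1}^{m-1}\mathcal{M}(\pi,Q_j)\Big), \qquad \alpha := \sqrt{1-\prod_{i=0}^{m-2}(1-\alpha_i^2)}.$$ Then for all $n\in\mathbb{N}$, $$ \|R_{mn} - R_\infty\|_F \leq \alpha^n \|P\|_F. $$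
   Context: $\mathcal{L}$ is the set of transition (row-stochastic) matrices on $\mathcal{X}$; $\mathcal{S}(\pi)\subseteq\mathcal{L}$ is the set of those with $\pi P=\pi$. $\mathcal{M}$ is the space of real matrices indexed by $\mathcal{X}\times\mathcal{X}$; $M^*(x,y)=\frac{\pi(y)}{\pi(x)}M(y,x)$. $\mathcal{L}(\pi)$ is the set of $\pi$-reversible transition matrices ($P=P^*$). $\mathcal{I}(\pi)$ is the set of $Q\in\mathcal{M}$ with $Q^2=I$ and $Q^*=Q$. $\mathcal{L}(\pi,Q)$ is the set of $L\in\mathcal{S}(\pi)$ with $L^*=QLQ$; $\mathcal{M}(\pi,Q):=\{M\in\mathcal{M}:M=QMQ\}$. For $P\in\mathcal{S}(\pi)$, $\overline{P}(Q):=\frac12(P+QP^*Q)$. For $M,N\in\mathcal{L}$, $D^\pi_{KL}(M\|N):=\sum_x\pi(x)\sum_y M(x,y)\ln\frac{M(x,y)}{N(x,y)}\in[0,\infty]$ with $0\ln(0/0)=0$, $0\cdot\infty=0$ and $a\ln(a/0)=+\infty$ for $a>0$. $\langle M,N\rangle_F:=\mathrm{Tr}(M^*N)$, $\|M\|_F:=\sqrt{\langle M,M\rangle_F}$. For subspaces $\mathcal{M}_1,\mathcal{M}_2$ of $\mathcal{M}$, the cosine of the angle between them is $\alpha(\mathcal{M}_1,\mathcal{M}_2):=\sup\{|\langle M_1,M_2\rangle_F|: M_i\in\mathcal{M}_i\cap(\mathcal{M}_1\cap\mathcal{M}_2)^\perp,\ \|M_i\|_F\le1,\ i\in\{1,2\}\}$,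 with $\perp$ taken with respect to $\langle\cdot,\cdot\rangle_F$. An empty product equals $1$. *)

theory Defs
  imports "HOL-Probability.Probability"
begin

definition transition_matrices :: "(real^'a^'a::finite) set" where
  "transition_matrices = {P. (\<forall>x y. 0 \<le> P $ x $ y) \<and> (\<forall>x. (\<Sum>y\<in>UNIV. P $ x $ y) = 1)}"

definition stationary_matrices :: "'a::finite pmf \<Rightarrow> (real^'a^'a) set" where
  "stationary_matrices \<pi> =
     {P \<in> transition_matrices. (\<chi> x. pmf \<pi> x) v* P = (\<chi> x. pmf \<pi> x)}"

definition pi_adjoint :: "'a::finite pmf \<Rightarrow> real^'a^'a \<Rightarrow> real^'a^'a" where
  "pi_adjoint \<pi> M = (\<chi> x y. pmf \<pi> y / pmf \<pi> x * M $ y $ x)"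

definition reversible_matrices :: "'a::finite pmf \<Rightarrow> (real^'a^'a) set" where
  "reversible_matrices \<pi> = {P \<in> transition_matrices. pi_adjoint \<pi> P = P}"

definition isometric_involutions :: "'a::finite pmf \<Rightarrow> (real^'a^'a) set" where
  "isometric_involutions \<pi> = {Q. Q ** Q = mat 1 \<and> pi_adjoint \<pi> Q = Q}"

definition Q_reversible_matrices :: "'a::finite pmf \<Rightarrow> real^'a^'a \<Rightarrow> (real^'a^'a) set" where
  "Q_reversible_matrices \<pi> Q =
     {L \<in> stationary_matrices \<pi>. pi_adjoint \<pi> L = Q ** L ** Q}"

text \<open>This is the space \<open>\<M>(\<pi>, Q)\<close>; its defining condition depends on \<open>Q\<close> only.\<close>

definition Q_invariant_matrices :: "real^'a^'a \<Rightarrow> (real^'a^'a::finite) set" where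
  "Q_invariant_matrices Q = {M. M = Q ** M ** Q}"

definition Q_average :: "'a::finite pmf \<Rightarrow> real^'a^'a \<Rightarrow> real^'a^'a \<Rightarrow> real^'a^'a" where
  "Q_average \<pi> P Q = (1 / 2) *\<^sub>R (P + Q ** pi_adjoint \<pi> P ** Q)"

text \<open>
  The summand \<open>a ln (a / b)\<close> for \<open>a, b \<ge> 0\<close>, with \<open>0 ln (0 / b) = 0\<close> also for \<open>b = 0\<close> and
  \<open>a ln (a / 0) = \<infinity>\<close> for \<open>a > 0\<close>. The library's \<open>KL_divergence\<close> is real-valued and so
  cannot express the infinite case.
\<close>

definition kl_term :: "real \<Rightarrow> real \<Rightarrow> ereal" where
  "kl_term a b = (if a = 0 then 0 else if b = 0 then \<infinity> else ereal (a * ln (a / b)))"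

definition KL_rate :: "'a::finite pmf \<Rightarrow> real^'a^'a \<Rightarrow> real^'a^'a \<Rightarrow> ereal" where
  "KL_rate \<pi> M N =
     (\<Sum>x\<in>UNIV. ereal (pmf \<pi> x) * (\<Sum>y\<in>UNIV. kl_term (M $ x $ y) (N $ x $ y)))"

definition frob_inner :: "'a::finite pmf \<Rightarrow> real^'a^'a \<Rightarrow> real^'a^'a \<Rightarrow> real" where
  "frob_inner \<pi> M N = trace (pi_adjoint \<pi> M ** N)"

definition frob_norm :: "'a::finite pmf \<Rightarrow> real^'a^'a \<Rightarrow> real" where
  "frob_norm \<pi> M = sqrt (frob_inner \<pi> M M)"

definition frob_orthogonal_comp :: "'a::finite pmf \<Rightarrow> (real^'a^'a) set \<Rightarrow> (real^'a^'a) set" where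
  "frob_orthogonal_comp \<pi> S = {M. \<forall>N\<in>S. frob_inner \<pi> M N = 0}"

text \<open>
  The supremum is taken in \<open>\<real>\<close>. For linear subspaces and a fully supported \<open>\<pi>\<close> the set contains
  \<open>0\<close> and is bounded by \<open>1\<close> (Cauchy-Schwarz).
\<close>

definition cos_angle :: "'a::finite pmf \<Rightarrow> (real^'a^'a) set \<Rightarrow> (real^'a^'a) set \<Rightarrow> real" where
  "cos_angle \<pi> S T = Sup {\<bar>frob_inner \<pi> M N\<bar> | M N.
     M \<in> S \<inter> frob_orthogonal_comp \<pi> (S \<inter> T) \<and> frob_norm \<pi> M \<le> 1 \<and>
     N \<in> T \<inter> frob_orthogonal_comp \<pi> (S \<inter> T) \<and> frob_norm \<pi> N \<le> 1}"

primrec avg_seq ::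
  "'a::finite pmf \<Rightarrow> nat \<Rightarrow> (nat \<Rightarrow> real^'a^'a) \<Rightarrow> real^'a^'a \<Rightarrow> nat \<Rightarrow> real^'a^'a" where
  "avg_seq \<pi> m Q P 0 = P"
| "avg_seq \<pi> m Q P (Suc n) = Q_average \<pi> (avg_seq \<pi> m Q P n) (Q (n mod m))"

definition is_KL_projection ::
  "'a::finite pmf \<Rightarrow> nat \<Rightarrow> (nat \<Rightarrow> real^'a^'a) \<Rightarrow> real^'a^'a \<Rightarrow> real^'a^'a \<Rightarrow> bool" where
  "is_KL_projection \<pi> m Q P R \<longleftrightarrow>
     is_arg_min (KL_rate \<pi> P) (\<lambda>N. N \<in> (\<Inter>k<m. Q_reversible_matrices \<pi> (Q k))) R"

definition avg_limit ::
  "'a::finite pmf \<Rightarrow> nat \<Rightarrow> (nat \<Rightarrow> real^'a^'a) \<Rightarrow> real^'a^'a \<Rightarrow> real^'a^'a" where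
  "avg_limit \<pi> m Q P = (THE R. is_KL_projection \<pi> m Q P R)"

definition angle_coeff :: "'a::finite pmf \<Rightarrow> nat \<Rightarrow> (nat \<Rightarrow> real^'a^'a) \<Rightarrow> nat \<Rightarrow> real" where
  "angle_coeff \<pi> m Q i =
     cos_angle \<pi> (Q_invariant_matrices (Q i)) (\<Inter>j\<in>{i<..<m}. Q_invariant_matrices (Q j))"

text \<open>
  For \<open>m \<ge> 1\<close> the index set \<open>{..<m - 1}\<close> is \<open>{0, \<dots>, m - 2}\<close>, which is empty for \<open>m = 1\<close>.
\<close>

definition rate :: "'a::finite pmf \<Rightarrow> nat \<Rightarrow> (nat \<Rightarrow> real^'a^'a) \<Rightarrow> real" where
  "rate \<pi> m Q = sqrt (1 - (\<Prod>i<m - 1. 1 - (angle_coeff \<pi> m Q i)\<^sup>2))"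

end

theory Submission
  imports Defs
begin

text \<open>
  A nonnegative stochastic involution is a permutation matrix, so \<open>M \<mapsto> Q M Q\<close> relabels the entries
  of \<open>M\<close>, and on reversible matrices each averaging step is the Frobenius-orthogonal projection onto
  \<open>\<M>(\<pi>, Q)\<close>. Let \<open>E\<close> be the orthogonal projection of \<open>P\<close> onto the intersection \<open>V\<close> of these spaces.
  Testing \<open>P - E \<bottom> V\<close> against the negative part of \<open>E\<close>, its row-sum defect and \<open>E - E\<^sup>*\<close> shows that
  \<open>E\<close> is a reversible transition matrix. For a competitor \<open>N\<close>, testing against a symmetrisation of
  \<open>ln (E / N)\<close> gives \<open>D(P \<parallel> N) = D(P \<parallel> E) + D(E \<parallel> N)\<close>, so \<open>E\<close> is the unique minimizer \<open>R\<^sub>\<infinity>\<close>.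
  The rate is the Smith-Solmon-Wagner bound for cyclic products of projections.
\<close>

section \<open>The weighted Frobenius inner product\<close>

text \<open>The rescaling turns \<open>frob_inner\<close> into the Euclidean inner product, so
  Cauchy-Schwarz and orthogonal decomposition carry over from there.\<close>

definition weighted :: "'a::finite pmf \<Rightarrow> real^'a^'a \<Rightarrow> real^'a^'a" where
  "weighted \<pi> M = (\<chi> x y. sqrt (pmf \<pi> x / pmf \<pi> y) * M $ x $ y)"

lemma linear_weighted: "linear (weighted \<pi>)"
  by (rule linearI) (simp_all add: weighted_def vec_eq_iff algebra_simps)

lemmas weighted_simps =
  linear_add[OF linear_weighted] linear_diff[OF linear_weighted] linear_0[OF linear_weighted]
  linear_scale[OF linear_weighted]

lemma frob_inner_eq_sum:
  "frob_inner \<pi> M N = (\<Sum>x\<in>UNIV. \<Sum>y\<in>UNIV. pmf \<pi> x / pmf \<pi> y * (M $ x $ y * N $ x $ y))"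
proof -
  have "frob_inner \<pi> M N = (\<Sum>y\<in>UNIV. \<Sum>x\<in>UNIV. pmf \<pi> x / pmf \<pi> y * (M $ x $ y * N $ x $ y))"
    by (simp add: frob_inner_def trace_def matrix_matrix_mult_def pi_adjoint_def mult.assoc)
  then show ?thesis
    by (subst (asm) sum.swap)
qed

lemma frob_inner_eq_weighted: "frob_inner \<pi> M N = weighted \<pi> M \<bullet> weighted \<pi> N"
proof -
  have sqrt: "sqrt w * a * (sqrt w * b) = w * (a * b)" if "w \<ge> 0" for w a b :: real
  proof -
    have "sqrt w * a * (sqrt w * b) = (sqrt w * sqrt w) * (a * b)"
      by (simp only: mult_ac)
    with that show ?thesis
      by simp
  qed
  then show ?thesis
    by (simp add: sqrt frob_inner_eq_sum inner_vec_def weighted_def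
        del: times_divide_eq_left real_sqrt_divide)
qed

lemma frob_norm_eq_weighted: "frob_norm \<pi> M = norm (weighted \<pi> M)"
  by (simp add: frob_norm_def frob_inner_eq_weighted norm_eq_sqrt_inner)

lemma frob_inner_commute: "frob_inner \<pi> M N = frob_inner \<pi> N M"
  by (simp add: frob_inner_eq_weighted inner_commute)

lemma frob_inner_simps:
  "frob_inner \<pi> (M + M') N = frob_inner \<pi> M N + frob_inner \<pi> M' N"
  "frob_inner \<pi> (M - M') N = frob_inner \<pi> M N - frob_inner \<pi> M' N"
  "frob_inner \<pi> (c *\<^sub>R M) N = c * frob_inner \<pi> M N"
  "frob_inner \<pi> N (M + M') = frob_inner \<pi> N M + frob_inner \<pi> N M'"
  "frob_inner \<pi> N (M - M') = frob_inner \<pi> N M - frob_inner \<pi> N M'"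
  "frob_inner \<pi> N (c *\<^sub>R M) = c * frob_inner \<pi> N M"
  "frob_inner \<pi> 0 N = 0"
  "frob_inner \<pi> N 0 = 0"
  by (simp_all add: frob_inner_eq_weighted weighted_simps inner_simps)

lemma frob_norm_nonneg: "0 \<le> frob_norm \<pi> M"
  by (simp add: frob_norm_eq_weighted)

lemma frob_norm_power2: "(frob_norm \<pi> M)\<^sup>2 = frob_inner \<pi> M M"
  by (simp add: frob_norm_eq_weighted frob_inner_eq_weighted power2_norm_eq_inner)

lemma frob_norm_scaleR: "frob_norm \<pi> (c *\<^sub>R M) = \<bar>c\<bar> * frob_norm \<pi> M"
  by (simp add: frob_norm_eq_weighted weighted_simps)

lemma frob_inner_Cauchy_Schwarz: "\<bar>frob_inner \<pi> M N\<bar> \<le> frob_norm \<pi> M * frob_norm \<pi> N"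
  by (simp add: frob_inner_eq_weighted frob_norm_eq_weighted Cauchy_Schwarz_ineq2)

lemma frob_norm_Pythagoras:
  assumes "frob_inner \<pi> M N = 0"
  shows "(frob_norm \<pi> (M + N))\<^sup>2 = (frob_norm \<pi> M)\<^sup>2 + (frob_norm \<pi> N)\<^sup>2"
  using assms by (simp add: frob_norm_power2 frob_inner_simps frob_inner_commute[of \<pi> N M])

lemma subspace_frob_orthogonal_comp: "subspace (frob_orthogonal_comp \<pi> S)"
  by (simp add: subspace_def frob_orthogonal_comp_def frob_inner_simps)

lemma frob_orthogonal_compD: "M \<in> frob_orthogonal_comp \<pi> S \<Longrightarrow> N \<in> S \<Longrightarrow> frob_inner \<pi> M N = 0"
  by (simp add: frob_orthogonal_comp_def)

text \<open>Full support makes every scaling factor in \<open>weighted\<close> nonzero, so the form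
  is definite and not merely semidefinite.\<close>

lemma frob_norm_eq_0_iff:
  assumes "set_pmf \<pi> = UNIV"
  shows "frob_norm \<pi> M = 0 \<longleftrightarrow> M = 0"
proof -
  have "pmf \<pi> x \<noteq> 0" for x
    using assms by (auto simp: set_pmf_eq)
  then show ?thesis
    by (simp add: frob_norm_eq_weighted weighted_def vec_eq_iff)
qed

lemma frob_inner_self_eq_0_iff:
  assumes "set_pmf \<pi> = UNIV"
  shows "frob_inner \<pi> M M = 0 \<longleftrightarrow> M = 0"
  using frob_norm_eq_0_iff[OF assms, of M] by (simp add: frob_norm_def)

text \<open>\<open>weighted \<pi> M\<close> is decomposed along the image of \<open>S\<close>, which
  is its own span; a preimage of the component in that image serves as \<open>E\<close>.\<close>

lemma frob_projection_exists:
  assumes "subspace S"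
  obtains E where "E \<in> S" "M - E \<in> frob_orthogonal_comp \<pi> S"
proof -
  have S: "span (weighted \<pi> ` S) = weighted \<pi> ` S"
    by (simp add: assms linear_weighted linear_subspace_image)
  obtain y z where y: "y \<in> span (weighted \<pi> ` S)"
    and z: "\<And>w. w \<in> span (weighted \<pi> ` S) \<Longrightarrow> orthogonal z w" and yz: "weighted \<pi> M = y + z"
    using orthogonal_subspace_decomp_exists[of "weighted \<pi> ` S" "weighted \<pi> M"] by blast
  from y obtain E where E: "E \<in> S" "y = weighted \<pi> E"
    unfolding S by blast
  have "weighted \<pi> (M - E) = z"
    using yz E by (simp add: weighted_simps)
  then have "M - E \<in> frob_orthogonal_comp \<pi> S"
    using z unfolding S by (auto simp: frob_orthogonal_comp_def frob_inner_eq_weighted orthogonal_def)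
  with E(1) show ?thesis
    by (rule that)
qed

section \<open>Angles and products of projections\<close>

context
  fixes \<pi> :: "'a::finite pmf" and S T :: "(real^'a^'a) set"
  assumes S: "subspace S" and T: "subspace T"
begin

text \<open>A name for the set under the supremum in \<open>cos_angle\<close>: a real supremum is
  usable only once this set is known to be nonempty and bounded.\<close>

private definition "angle_values = {\<bar>frob_inner \<pi> M N\<bar> | M N.
     M \<in> S \<inter> frob_orthogonal_comp \<pi> (S \<inter> T) \<and> frob_norm \<pi> M \<le> 1 \<and>
     N \<in> T \<inter> frob_orthogonal_comp \<pi> (S \<inter> T) \<and> frob_norm \<pi> N \<le> 1}"

private lemma angle_values_le_1: "r \<in> angle_values \<Longrightarrow> r \<le> 1"
  unfolding angle_values_def
  by (auto intro!: order_trans[OF frob_inner_Cauchy_Schwarz] mult_le_one frob_norm_nonneg)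

private lemma angle_values_le_cos: "r \<in> angle_values \<Longrightarrow> r \<le> cos_angle \<pi> S T"
  unfolding cos_angle_def angle_values_def[symmetric]
  by (rule cSup_upper) (use angle_values_le_1 in \<open>auto intro!: bdd_aboveI\<close>)

private lemma zero_in_angle_values: "0 \<in> angle_values"
  unfolding angle_values_def using S T subspace_frob_orthogonal_comp[of \<pi> "S \<inter> T"]
  by (auto intro!: exI[of _ 0] simp: frob_inner_simps frob_norm_def subspace_0)

lemma cos_angle_nonneg: "0 \<le> cos_angle \<pi> S T"
  by (rule angle_values_le_cos[OF zero_in_angle_values])

lemma cos_angle_le_1: "cos_angle \<pi> S T \<le> 1"
  unfolding cos_angle_def angle_values_def[symmetric]
  by (rule cSup_least) (use zero_in_angle_values angle_values_le_1 in auto)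

text \<open>Both sides are homogeneous, so it suffices to normalise \<open>M\<close> and
  \<open>N\<close>; if one norm vanishes, Cauchy-Schwarz already gives 0.\<close>

lemma cos_angle_bound:
  assumes M: "M \<in> S" "M \<in> frob_orthogonal_comp \<pi> (S \<inter> T)"
    and N: "N \<in> T" "N \<in> frob_orthogonal_comp \<pi> (S \<inter> T)"
  shows "\<bar>frob_inner \<pi> M N\<bar> \<le> cos_angle \<pi> S T * (frob_norm \<pi> M * frob_norm \<pi> N)"
proof (cases "frob_norm \<pi> M * frob_norm \<pi> N = 0")
  case True
  then show ?thesis
    using frob_inner_Cauchy_Schwarz[of \<pi> M N] by auto
next
  case False
  let ?M = "inverse (frob_norm \<pi> M) *\<^sub>R M" and ?N = "inverse (frob_norm \<pi> N) *\<^sub>R N"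
  have pos: "frob_norm \<pi> M > 0" "frob_norm \<pi> N > 0"
    using False frob_norm_nonneg[of \<pi> M] frob_norm_nonneg[of \<pi> N] by auto
  have "\<bar>frob_inner \<pi> ?M ?N\<bar> \<in> angle_values"
    unfolding angle_values_def using pos S T M N subspace_frob_orthogonal_comp[of \<pi> "S \<inter> T"]
    by (intro CollectI exI[of _ ?M] exI[of _ ?N])
      (auto simp: frob_norm_scaleR subspace_scale)
  then have "\<bar>frob_inner \<pi> ?M ?N\<bar> \<le> cos_angle \<pi> S T"
    by (rule angle_values_le_cos)
  then show ?thesis
    using pos by (simp add: frob_inner_simps abs_mult field_simps)
qed

end

text \<open>The start \<open>i\<close> is arbitrary so that induction can run down from the last
  projection. After projecting to \<open>S i\<close>, the component in the intersection of the later
  spaces is fixed by the later maps and limited by the angle; the rest shrinks by the induction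
  hypothesis.\<close>

lemma alternating_projections_bound:
  fixes \<pi> :: "'a::finite pmf" and S :: "nat \<Rightarrow> (real^'a^'a) set"
    and T :: "nat \<Rightarrow> real^'a^'a \<Rightarrow> real^'a^'a" and m :: nat
  defines "c \<equiv> \<lambda>i. cos_angle \<pi> (S i) (\<Inter>j\<in>{i<..<m}. S j)"
  assumes full: "set_pmf \<pi> = UNIV"
    and S: "\<And>i. i < m \<Longrightarrow> subspace (S i)"
    and T: "\<And>i. i < m \<Longrightarrow> linear (T i)"
    and T_in: "\<And>i M. i < m \<Longrightarrow> T i M \<in> S i"
    and T_orth: "\<And>i M. i < m \<Longrightarrow> M - T i M \<in> frob_orthogonal_comp \<pi> (S i)"
    and "i < m" and "M \<in> frob_orthogonal_comp \<pi> (\<Inter>j\<in>{i..<m}. S j)"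
  shows "(frob_norm \<pi> (fold T [i..<m] M))\<^sup>2
    \<le> (1 - (\<Prod>k\<in>{i..<m - 1}. 1 - (c k)\<^sup>2)) * (frob_norm \<pi> M)\<^sup>2"
proof -
  have T_fix: "T k N = N" if "k < m" "N \<in> S k" for k N
  proof -
    have "N - T k N \<in> S k"
      using that by (simp add: S T_in subspace_diff)
    then have "frob_inner \<pi> (N - T k N) (N - T k N) = 0"
      using T_orth[OF that(1)] by (blast intro: frob_orthogonal_compD)
    then show ?thesis
      by (simp add: frob_inner_self_eq_0_iff[OF full])
  qed
  have c: "0 \<le> c k" "c k \<le> 1" if "k < m" for k
    unfolding c_def using that
    by (auto intro!: cos_angle_nonneg cos_angle_le_1 subspace_Inter S)
  have fold_add: "fold T ks (M + N) = fold T ks M + fold T ks N" if "set ks \<subseteq> {..<m}" for ks M N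
    using that by (induction ks arbitrary: M N) (auto simp: linear_add[OF T])
  have fold_fix: "fold T ks N = N" if "set ks \<subseteq> {..<m}" "\<And>k. k \<in> set ks \<Longrightarrow> N \<in> S k" for ks N
    using that by (induction ks) (auto simp: T_fix)
  \<comment> \<open>Each map changes its argument by something orthogonal to a space containing
    \<open>N\<close>.\<close>
  have fold_orth: "frob_inner \<pi> (fold T ks M) N = frob_inner \<pi> M N"
    if "set ks \<subseteq> {..<m}" "\<And>k. k \<in> set ks \<Longrightarrow> N \<in> S k" for ks M N
    using that
  proof (induction ks arbitrary: M)
    case (Cons k ks)
    have "frob_inner \<pi> (M - T k M) N = 0"
      using Cons.prems by (intro frob_orthogonal_compD[OF T_orth[of k M]]) auto
    with Cons show ?case
      by (simp add: frob_inner_simps)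
  qed simp
  have "i \<le> m - 1"
    using \<open>i < m\<close> by simp
  then show ?thesis
    using assms(8)
  proof (induction arbitrary: M rule: inc_induct)
    \<comment> \<open>One projection is left and the product is empty, so the claimed bound is 0:
      \<open>M\<close> is orthogonal to \<open>S (m - 1)\<close> and must be projected to 0.\<close>
    case base
    have m: "{m - 1..<m} = {m - 1}" "[m - 1..<m] = [m - 1]" "fold T [m - 1..<m] M = T (m - 1) M"
      using \<open>i < m\<close> by (auto simp: upt_rec)
    let ?y = "T (m - 1) M"
    have "?y \<in> S (m - 1)"
      using \<open>i < m\<close> by (simp add: T_in)
    then have "frob_inner \<pi> M ?y = 0"
      using base[unfolded m] by (simp add: frob_orthogonal_comp_def)
    with \<open>?y \<in> S (m - 1)\<close> have "frob_inner \<pi> ?y ?y = 0"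
      using fold_orth[of "[m - 1]" ?y M] \<open>i < m\<close> by simp
    then show ?case
      by (simp add: m(3)[simplified] frob_inner_self_eq_0_iff[OF full] frob_norm_def)
  next
    case (step n)
    have n: "n < m" "n < m - 1" "Suc n < m"
      using step.hyps by auto
    define N where "N = (\<Inter>j\<in>{Suc n..<m}. S j)"
    have N_alt: "(\<Inter>j\<in>{n<..<m}. S j) = N"
      by (simp add: N_def atLeastSucLessThan_greaterThanLessThan)
    have inter: "(\<Inter>j\<in>{n..<m}. S j) = S n \<inter> N"
    proof -
      have "{n..<m} = insert n {Suc n..<m}"
        using n(1) by auto
      then show ?thesis
        by (simp add: N_def)
    qed
    have sub: "subspace N"
      unfolding N_def by (rule subspace_Inter) (auto simp: S)
    define y where "y = T n M"
    have y: "y \<in> S n"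
      by (simp add: y_def T_in n)
    have My: "frob_inner \<pi> y (M - y) = 0"
      using T_orth[OF n(1), of M] y
      by (simp add: y_def frob_inner_commute[of \<pi> "T n M"] frob_orthogonal_comp_def)
    have y_le: "(frob_norm \<pi> y)\<^sup>2 \<le> (frob_norm \<pi> M)\<^sup>2"
      using frob_norm_Pythagoras[OF My] by simp
    have y_perp: "y \<in> frob_orthogonal_comp \<pi> (S n \<inter> N)"
      using step.prems fold_orth[of "[n]" _ M] n(1) unfolding inter
      by (auto simp: frob_orthogonal_comp_def y_def)
    obtain y1 where y1: "y1 \<in> N" and perp: "y - y1 \<in> frob_orthogonal_comp \<pi> N"
      using frob_projection_exists[OF sub] .
    \<comment> \<open>Now \<open>y\<close> and \<open>y1\<close> are both orthogonal to
      \<open>S n \<inter> N\<close>, hence an admissible pair for the angle between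
      \<open>S n\<close> and \<open>N\<close>.\<close>
    have y1_perp: "y1 \<in> frob_orthogonal_comp \<pi> (S n \<inter> N)"
      using y_perp perp by (auto simp: frob_orthogonal_comp_def frob_inner_simps)
    define y2 where "y2 = y - y1"
    have y12: "frob_inner \<pi> y1 y2 = 0"
      using perp y1 by (simp add: y2_def frob_orthogonal_comp_def frob_inner_commute[of \<pi> y1])
    have Py: "(frob_norm \<pi> y)\<^sup>2 = (frob_norm \<pi> y1)\<^sup>2 + (frob_norm \<pi> y2)\<^sup>2"
      using frob_norm_Pythagoras[OF y12] by (simp add: y2_def)
    have "(frob_norm \<pi> y1)\<^sup>2 = frob_inner \<pi> y y1"
      using y12 by (simp add: y2_def frob_norm_power2 frob_inner_simps frob_inner_commute[of \<pi> y])
    also have "\<dots> \<le> c n * (frob_norm \<pi> y * frob_norm \<pi> y1)"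
      using cos_angle_bound[OF S[OF n(1)] sub y y_perp y1 y1_perp] by (simp add: c_def N_alt)
    finally have "frob_norm \<pi> y1 * frob_norm \<pi> y1 \<le> (c n * frob_norm \<pi> y) * frob_norm \<pi> y1"
      by (simp add: power2_eq_square mult_ac)
    then have "frob_norm \<pi> y1 \<le> c n * frob_norm \<pi> y"
      using c(1)[OF n(1)] frob_norm_nonneg[of \<pi> y1] frob_norm_nonneg[of \<pi> y]
      by (cases "frob_norm \<pi> y1 = 0") auto
    then have "(frob_norm \<pi> y1)\<^sup>2 \<le> (c n * frob_norm \<pi> y)\<^sup>2"
      by (rule power_mono) (rule frob_norm_nonneg)
    then have angle: "(1 - (c n)\<^sup>2) * (frob_norm \<pi> y)\<^sup>2 \<le> (frob_norm \<pi> y2)\<^sup>2"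
      using Py by (simp add: power_mult_distrib algebra_simps)
    let ?A = "fold T [Suc n..<m]" and ?d = "\<lambda>n. \<Prod>k\<in>{n..<m - 1}. 1 - (c k)\<^sup>2"
    have d: "0 \<le> ?d k" for k
      by (intro prod_nonneg) (auto simp: c power_le_one)
    have dn: "?d n = (1 - (c n)\<^sup>2) * ?d (Suc n)"
      using n by (simp add: prod.atLeast_Suc_lessThan)
    have d1: "?d n \<le> 1"
      by (intro prod_le_1) (auto simp: c power_le_one)
    have Ay1: "?A y1 = y1"
      using y1 by (intro fold_fix) (auto simp: N_def)
    have Ay: "?A y = y1 + ?A y2"
      using fold_add[of "[Suc n..<m]" y1 y2] Ay1 by (simp add: y2_def subset_iff)
    \<comment> \<open>The later maps keep inner products with \<open>y1\<close>, so the two summands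
      of \<open>?A y\<close> stay orthogonal and Pythagoras applies.\<close>
    have orth: "frob_inner \<pi> y1 (?A y2) = 0"
      using fold_orth[of "[Suc n..<m]" y1 y2] y1 y12
      by (simp add: N_def frob_inner_commute[of \<pi> y1] subset_iff)
    have "fold T [n..<m] M = ?A y"
      using n by (simp add: upt_conv_Cons y_def)
    then have "(frob_norm \<pi> (fold T [n..<m] M))\<^sup>2 = (frob_norm \<pi> y1)\<^sup>2 + (frob_norm \<pi> (?A y2))\<^sup>2"
      by (simp add: Ay frob_norm_Pythagoras[OF orth])
    also have "\<dots> \<le> (frob_norm \<pi> y1)\<^sup>2 + (1 - ?d (Suc n)) * (frob_norm \<pi> y2)\<^sup>2"
      using step.IH[of y2] perp by (simp add: N_def y2_def)
    \<comment> \<open>Eliminating \<open>y1\<close> leaves \<open>y2\<close> with a nonpositive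
      coefficient, which is why \<open>angle\<close> bounds \<open>y2\<close> from below.\<close>
    also have "\<dots> = (frob_norm \<pi> y)\<^sup>2 - ?d (Suc n) * (frob_norm \<pi> y2)\<^sup>2"
      by (simp add: Py algebra_simps)
    also have "\<dots> \<le> (frob_norm \<pi> y)\<^sup>2 - ?d (Suc n) * ((1 - (c n)\<^sup>2) * (frob_norm \<pi> y)\<^sup>2)"
      using mult_left_mono[OF angle d[of "Suc n"]] by simp
    also have "\<dots> = (1 - ?d n) * (frob_norm \<pi> y)\<^sup>2"
      unfolding dn by (simp only: algebra_simps)
    also have "\<dots> \<le> (1 - ?d n) * (frob_norm \<pi> M)\<^sup>2"
      using y_le d1 by (intro mult_left_mono) auto
    finally show ?case .
  qed
qed


section \<open>Stochastic involutions are permutations\<close>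

text \<open>Nonnegative entries cannot cancel in \<open>Q ** Q\<close>: if
  \<open>Q $ x $ y > 0\<close>, the zero off-diagonal entries of the identity leave row
  \<open>y\<close> supported at \<open>x\<close> only, and the row sum makes that entry 1.
  Self-adjointness then equates the masses of \<open>x\<close> and \<open>s x\<close>.\<close>

lemma stochastic_involution_permutation:
  fixes \<pi> :: "'a::finite pmf"
  assumes full: "set_pmf \<pi> = UNIV"
    and Q: "Q \<in> isometric_involutions \<pi> \<inter> transition_matrices"
  obtains s where "\<And>x y. Q $ x $ y = of_bool (y = s x)" "\<And>x. s (s x) = x"
    "\<And>x. pmf \<pi> (s x) = pmf \<pi> x"
proof -
  have nonneg: "Q $ x $ y \<ge> 0" and row: "(\<Sum>y\<in>UNIV. Q $ x $ y) = 1" for x y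
    using Q by (auto simp: transition_matrices_def)
  have pi_pos: "pmf \<pi> x > 0" for x
    using full by (simp add: pmf_positive)
  have sq: "(\<Sum>z\<in>UNIV. Q $ x $ z * Q $ z $ x') = of_bool (x = x')" for x x'
  proof -
    have "(Q ** Q) $ x $ x' = mat 1 $ x $ x'"
      using Q by (simp add: isometric_involutions_def)
    then show ?thesis
      by (simp add: matrix_matrix_mult_def mat_def)
  qed
  have support: "Q $ y $ x' = of_bool (x' = x)" if "Q $ x $ y > 0" for x y x'
  proof -
    have zero: "Q $ y $ z = 0" if "z \<noteq> x" for z
    proof -
      have "Q $ x $ y * Q $ y $ z \<le> (\<Sum>w\<in>UNIV. Q $ x $ w * Q $ w $ z)"
        by (rule member_le_sum) (auto simp: nonneg)
      also have "\<dots> = 0"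
        using sq[of x z] that by simp
      finally show ?thesis
        using \<open>Q $ x $ y > 0\<close> nonneg[of y z] by (simp add: mult_le_0_iff)
    qed
    have "(\<Sum>z\<in>UNIV. Q $ y $ z) = Q $ y $ x"
      using zero by (subst sum.remove[of _ x]) auto
    then show ?thesis
      using zero row[of y] by simp
  qed
  have "\<exists>y. Q $ x $ y > 0" for x
  proof (rule ccontr)
    assume "\<nexists>y. Q $ x $ y > 0"
    then have "(\<Sum>y\<in>UNIV. Q $ x $ y) \<le> 0"
      by (intro sum_nonpos) (auto simp: not_less)
    with row[of x] show False
      by simp
  qed
  then obtain s where s: "\<And>x. Q $ x $ s x > 0"
    by metis
  \<comment> \<open>\<open>support\<close> is used twice: \<open>Q $ x $ s x > 0\<close> determines
    row \<open>s x\<close>, and its entry 1 at \<open>x\<close> determines row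
    \<open>x\<close>.\<close>
  have Qs: "Q $ x $ y = of_bool (y = s x)" for x y
    using support[of "s x" x y] support[OF s[of x], of x] by simp
  moreover have ss: "s (s x) = x" for x
    using support[OF s[of x], of x] Qs[of "s x" x] by (simp split: if_splits)
  moreover have "pmf \<pi> (s x) = pmf \<pi> x" for x
  proof -
    have "pi_adjoint \<pi> Q $ x $ s x = Q $ x $ s x"
      using Q by (simp add: isometric_involutions_def)
    then show ?thesis
      using pi_pos[of x] by (simp add: pi_adjoint_def Qs ss)
  qed
  ultimately show ?thesis
    by (rule that)
qed

section \<open>Relabelling by involutions and the averaging projections\<close>

locale stochastic_involutions =
  fixes \<pi> :: "'a::finite pmf" and m :: nat and Q :: "nat \<Rightarrow> real^'a^'a" and s :: "nat \<Rightarrow> 'a \<Rightarrow> 'a"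
  assumes full: "set_pmf \<pi> = UNIV"
    and Q_eq: "\<And>k x y. k < m \<Longrightarrow> Q k $ x $ y = of_bool (y = s k x)"
    and s_s [simp]: "\<And>k x. k < m \<Longrightarrow> s k (s k x) = x"
    and pi_s [simp]: "\<And>k x. k < m \<Longrightarrow> pmf \<pi> (s k x) = pmf \<pi> x"
begin

lemma pi_pos [simp]: "0 < pmf \<pi> x"
  using full by (simp add: pmf_positive)

lemma pi_neq_0 [simp]: "pmf \<pi> x \<noteq> 0"
  using pi_pos[of x] by linarith

lemma sum_s: "k < m \<Longrightarrow> (\<Sum>x\<in>UNIV. f (s k x)) = (\<Sum>x\<in>UNIV. f x)"
  by (rule sum.reindex_bij_witness[of _ "s k" "s k"]) auto

lemma Q_conj:
  assumes "k < m"
  shows "(Q k ** M ** Q k) $ x $ y = M $ s k x $ s k y"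
proof -
  have "y = s k z \<longleftrightarrow> z = s k y" for z
    using assms by auto
  then show ?thesis
    using assms by (simp add: matrix_matrix_mult_def Q_eq of_bool_def if_distrib if_distribR cong: if_cong)
qed

lemma in_Q_invariant_iff:
  "k < m \<Longrightarrow> M \<in> Q_invariant_matrices (Q k) \<longleftrightarrow> (\<forall>x y. M $ s k x $ s k y = M $ x $ y)"
  by (auto simp: Q_invariant_matrices_def vec_eq_iff Q_conj)

lemma subspace_Q_invariant: "k < m \<Longrightarrow> subspace (Q_invariant_matrices (Q k))"
  by (auto simp: subspace_def in_Q_invariant_iff)

definition invariants :: "(real^'a^'a) set" where
  "invariants = (\<Inter>k<m. Q_invariant_matrices (Q k))"

lemma in_invariants_iff:
  "M \<in> invariants \<longleftrightarrow> (\<forall>k<m. \<forall>x y. M $ s k x $ s k y = M $ x $ y)"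
  by (auto simp: invariants_def in_Q_invariant_iff)

text \<open>\<open>Q_average\<close> with the adjoint dropped; the two agree on reversible matrices,
  and this form is an orthogonal projection on the whole matrix space.\<close>

definition proj :: "nat \<Rightarrow> real^'a^'a \<Rightarrow> real^'a^'a" where
  "proj k M = (1 / 2) *\<^sub>R (M + Q k ** M ** Q k)"

lemma linear_proj: "k < m \<Longrightarrow> linear (proj k)"
  by (rule linearI) (simp_all add: proj_def vec_eq_iff Q_conj algebra_simps)

lemma proj_in: "k < m \<Longrightarrow> proj k M \<in> Q_invariant_matrices (Q k)"
  by (simp add: in_Q_invariant_iff proj_def Q_conj)

text \<open>Reindexing both sums by the \<pi>-preserving bijection \<open>s k\<close> shows that
  \<open>M\<close> and its conjugate have the same inner product with any invariant
  \<open>N\<close>.\<close>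

lemma proj_orth:
  assumes k: "k < m"
  shows "M - proj k M \<in> frob_orthogonal_comp \<pi> (Q_invariant_matrices (Q k))"
  unfolding frob_orthogonal_comp_def
proof safe
  fix N
  assume N: "N \<in> Q_invariant_matrices (Q k)"
  have "frob_inner \<pi> (Q k ** M ** Q k) N
    = (\<Sum>x\<in>UNIV. \<Sum>y\<in>UNIV. pmf \<pi> (s k x) / pmf \<pi> (s k y) * (M $ s k x $ s k y * N $ s k x $ s k y))"
    using N k by (simp add: frob_inner_eq_sum Q_conj in_Q_invariant_iff)
  also have "\<dots> = (\<Sum>x\<in>UNIV. \<Sum>y\<in>UNIV. pmf \<pi> (s k x) / pmf \<pi> y * (M $ s k x $ y * N $ s k x $ y))"
    by (intro sum.cong refl sum_s k)
  also have "\<dots> = frob_inner \<pi> M N"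
    unfolding frob_inner_eq_sum by (rule sum_s[OF k])
  finally show "frob_inner \<pi> (M - proj k M) N = 0"
    by (simp add: proj_def frob_inner_simps)
qed

lemma pi_adjoint_eq_iff:
  "pi_adjoint \<pi> M = M \<longleftrightarrow> (\<forall>x y. pmf \<pi> x * M $ x $ y = pmf \<pi> y * M $ y $ x)"
  by (auto simp: pi_adjoint_def vec_eq_iff field_simps)

lemma reversible_iff:
  "M \<in> reversible_matrices \<pi> \<longleftrightarrow> (\<forall>x y. 0 \<le> M $ x $ y) \<and> (\<forall>x. (\<Sum>y\<in>UNIV. M $ x $ y) = 1) \<and>
     (\<forall>x y. pmf \<pi> x * M $ x $ y = pmf \<pi> y * M $ y $ x)"
  by (auto simp: reversible_matrices_def transition_matrices_def pi_adjoint_eq_iff)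

lemma proj_reversible:
  assumes "k < m" "M \<in> reversible_matrices \<pi>"
  shows "proj k M \<in> reversible_matrices \<pi>"
proof -
  have M: "\<And>x y. 0 \<le> M $ x $ y" "\<And>x. (\<Sum>y\<in>UNIV. M $ x $ y) = 1"
    "\<And>x y. pmf \<pi> x * M $ x $ y = pmf \<pi> y * M $ y $ x"
    using assms by (auto simp: reversible_iff)
  have "pmf \<pi> x * M $ s k x $ s k y = pmf \<pi> y * M $ s k y $ s k x" for x y
    using M(3)[of "s k x" "s k y"] assms by simp
  moreover have "(\<Sum>y\<in>UNIV. M $ s k x $ s k y) = 1" for x
    using sum_s[OF assms(1), of "\<lambda>y. M $ s k x $ y"] M(2) by simp
  ultimately show ?thesis
    using assms(1) M
    by (simp add: reversible_iff proj_def Q_conj distrib_left sum.distrib flip: sum_distrib_left sum_divide_distrib)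
qed

lemma Q_average_eq_proj:
  "M \<in> reversible_matrices \<pi> \<Longrightarrow> Q_average \<pi> M (Q k) = proj k M"
  by (simp add: Q_average_def proj_def reversible_matrices_def)

text \<open>
  The factor \<open>\<pi>(y)\<close> in the test matrix cancels the denominator of the Frobenius weight \<open>\<pi>(x) / \<pi>(y)\<close>.
\<close>

lemma orth_invariants_sum_eq_0:
  assumes M: "M \<in> frob_orthogonal_comp \<pi> invariants"
    and g: "\<And>k x y. k < m \<Longrightarrow> g (s k x) (s k y) = g x y"
  shows "(\<Sum>x\<in>UNIV. \<Sum>y\<in>UNIV. pmf \<pi> x * (M $ x $ y * g x y)) = 0"
proof -
  have "(\<chi> x y. g x y * pmf \<pi> y) \<in> invariants"
    by (simp add: in_invariants_iff g)
  then have "frob_inner \<pi> M (\<chi> x y. g x y * pmf \<pi> y) = 0"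
    by (rule frob_orthogonal_compD[OF M])
  then show ?thesis
    by (simp add: frob_inner_eq_sum)
qed

section \<open>The orthogonal projection of \<open>P\<close> as a reversible transition
  matrix\<close>

lemma projection_reversible:
  assumes P: "P \<in> reversible_matrices \<pi>" and E: "E \<in> invariants"
    and orth: "P - E \<in> frob_orthogonal_comp \<pi> invariants"
  shows "E \<in> reversible_matrices \<pi>"
proof -
  have P': "\<And>x y. 0 \<le> P $ x $ y" "\<And>x. (\<Sum>y\<in>UNIV. P $ x $ y) = 1"
    "\<And>x y. pmf \<pi> x * P $ x $ y = pmf \<pi> y * P $ y $ x"
    using P by (auto simp: reversible_iff)
  have E': "E $ s k x $ s k y = E $ x $ y" if "k < m" for k x y
    using E that by (simp add: in_invariants_iff)
  have "0 \<le> E $ x $ y" for x y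
  proof -
    \<comment> \<open>Where \<open>E\<close> is negative, \<open>P - E\<close> is positive, so every
      summand is nonnegative and a vanishing sum rules out negative entries.\<close>
    let ?g = "\<lambda>x y. max 0 (- E $ x $ y)"
    have "(\<Sum>x\<in>UNIV. \<Sum>y\<in>UNIV. pmf \<pi> x * ((P - E) $ x $ y * ?g x y)) = 0"
      by (rule orth_invariants_sum_eq_0[OF orth]) (simp add: E')
    moreover have nonneg: "0 \<le> pmf \<pi> x * ((P - E) $ x $ y * ?g x y)" for x y
    proof (cases "E $ x $ y \<le> 0")
      case True
      then show ?thesis
        using P'(1)[of x y] by (intro mult_nonneg_nonneg) auto
    qed (simp add: max_def)
    ultimately have "pmf \<pi> x * ((P - E) $ x $ y * ?g x y) = 0"
      by (simp add: sum_nonneg_eq_0_iff sum_nonneg)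
    then show ?thesis
      using P'(1)[of x y] by (auto simp: max_def split: if_splits)
  qed
  moreover have "(\<Sum>y\<in>UNIV. E $ x $ y) = 1" for x
  proof -
    \<comment> \<open>The row defect is constant along a row, and rows of \<open>P\<close> sum to 1,
      so pairing it with \<open>P - E\<close> gives a weighted sum of squared defects.\<close>
    let ?f = "\<lambda>x. 1 - (\<Sum>y\<in>UNIV. E $ x $ y)"
    have "(\<Sum>y\<in>UNIV. E $ s k x $ y) = (\<Sum>y\<in>UNIV. E $ x $ y)" if "k < m" for k x
      using sum_s[OF that, of "\<lambda>y. E $ s k x $ y"] E'[OF that] by simp
    then have "(\<Sum>x\<in>UNIV. \<Sum>y\<in>UNIV. pmf \<pi> x * ((P - E) $ x $ y * ?f x)) = 0"
      by (intro orth_invariants_sum_eq_0[OF orth]) simp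
    moreover have "(\<Sum>y\<in>UNIV. pmf \<pi> x * ((P - E) $ x $ y * ?f x)) = pmf \<pi> x * (?f x * ?f x)" for x
      by (simp add: sum_subtractf P'(2) flip: sum_distrib_left sum_distrib_right)
    ultimately have "pmf \<pi> x * (?f x * ?f x) = 0"
      by (simp add: sum_nonneg_eq_0_iff)
    then show ?thesis
      by simp
  qed
  moreover have "pmf \<pi> x * E $ x $ y = pmf \<pi> y * E $ y $ x" for x y
  proof -
    \<comment> \<open>\<open>?D\<close> is the adjoint of \<open>P - E\<close> minus
      \<open>P - E\<close> itself. Moving the adjoint to the other side pairs \<open>P - E\<close>
      with invariant matrices only, so \<open>?D\<close> is orthogonal to itself.\<close>
    let ?D = "E - pi_adjoint \<pi> E"
    have adj: "frob_inner \<pi> (pi_adjoint \<pi> M) N = frob_inner \<pi> M (pi_adjoint \<pi> N)" for M N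
      unfolding frob_inner_eq_sum
      by (subst sum.swap) (simp add: pi_adjoint_def mult_ac)
    have D: "?D \<in> invariants" "pi_adjoint \<pi> ?D \<in> invariants"
      using E' by (simp_all add: in_invariants_iff pi_adjoint_def)
    have "pi_adjoint \<pi> P = P"
      using P by (simp add: reversible_matrices_def)
    have "frob_inner \<pi> (P - E) ?D = 0" "frob_inner \<pi> (P - E) (pi_adjoint \<pi> ?D) = 0"
      using D by (auto intro: frob_orthogonal_compD[OF orth])
    moreover have "pi_adjoint \<pi> (P - E) = P - pi_adjoint \<pi> E"
      using \<open>pi_adjoint \<pi> P = P\<close> by (simp add: pi_adjoint_def vec_eq_iff algebra_simps)
    moreover have "?D = (P - pi_adjoint \<pi> E) - (P - E)"
      by simp
    ultimately have "frob_inner \<pi> ?D ?D = 0"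
      by (metis adj frob_inner_simps(2) diff_self)
    then have "pi_adjoint \<pi> E = E"
      by (simp add: frob_inner_self_eq_0_iff[OF full])
    then show ?thesis
      by (simp add: pi_adjoint_eq_iff)
  qed
  ultimately show ?thesis
    by (simp add: reversible_iff)
qed

lemma reversible_stationary: "M \<in> reversible_matrices \<pi> \<Longrightarrow> M \<in> stationary_matrices \<pi>"
proof -
  assume M: "M \<in> reversible_matrices \<pi>"
  then have "(\<Sum>x\<in>UNIV. M $ x $ y * pmf \<pi> x) = pmf \<pi> y" for y
  proof -
    have "(\<Sum>x\<in>UNIV. M $ x $ y * pmf \<pi> x) = (\<Sum>x\<in>UNIV. pmf \<pi> y * M $ y $ x)"
      using M by (intro sum.cong) (auto simp: reversible_iff mult.commute)
    also have "\<dots> = pmf \<pi> y"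
      using M unfolding reversible_iff sum_distrib_left[symmetric] by simp
    finally show ?thesis .
  qed
  with M show ?thesis
    by (simp add: stationary_matrices_def reversible_matrices_def vector_matrix_mult_def mult_ac)
qed

lemma Q_reversible_iff:
  assumes "k < m"
  shows "N \<in> Q_reversible_matrices \<pi> (Q k) \<longleftrightarrow> N \<in> stationary_matrices \<pi> \<and>
    (\<forall>x y. pmf \<pi> y * N $ y $ x = pmf \<pi> x * N $ s k x $ s k y)"
  using assms by (auto simp: Q_reversible_matrices_def vec_eq_iff Q_conj pi_adjoint_def field_simps)

lemma projection_in_Q_reversible:
  assumes "E \<in> reversible_matrices \<pi>" "E \<in> invariants"
  shows "E \<in> (\<Inter>k<m. Q_reversible_matrices \<pi> (Q k))"
  using assms by (simp add: Q_reversible_iff in_invariants_iff reversible_iff reversible_stationary)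

section \<open>The Kullback-Leibler projection\<close>

lemma KL_rate_eq:
  assumes "\<And>x y. N $ x $ y = 0 \<Longrightarrow> M $ x $ y = 0"
  shows "KL_rate \<pi> M N
    = ereal (\<Sum>x\<in>UNIV. \<Sum>y\<in>UNIV. pmf \<pi> x * (M $ x $ y * ln (M $ x $ y / N $ x $ y)))"
proof -
  have "kl_term (M $ x $ y) (N $ x $ y) = ereal (M $ x $ y * ln (M $ x $ y / N $ x $ y))" for x y
    using assms[of x y] by (auto simp: kl_term_def)
  then show ?thesis
    by (simp add: KL_rate_def sum_distrib_left)
qed

text \<open>Full support keeps the weight of row \<open>x\<close> positive, so the infinite summand
  is not absorbed by \<open>0 * \<infinity> = 0\<close>.\<close>

lemma KL_rate_infinite:
  assumes "N $ x $ y = 0" "M $ x $ y \<noteq> 0"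
  shows "KL_rate \<pi> M N = \<infinity>"
proof -
  have "kl_term (M $ x $ y) (N $ x $ y) = \<infinity>"
    using assms by (simp add: kl_term_def)
  then have "(\<Sum>y\<in>UNIV. kl_term (M $ x $ y) (N $ x $ y)) = \<infinity>"
    by (auto simp: sum_Pinfty)
  then have "ereal (pmf \<pi> x) * (\<Sum>y\<in>UNIV. kl_term (M $ x $ y) (N $ x $ y)) = \<infinity>"
    by simp
  then show ?thesis
    unfolding KL_rate_def sum_Pinfty by auto
qed

text \<open>The hypothesis on \<open>g\<close> makes \<open>g\<close> plus its transpose invariant,
  hence orthogonal to \<open>P - E\<close> in the weighted sense. Detailed balance gives
  \<open>g\<close> and its transpose the same pairing, so each pairing is 0.\<close>

lemma projection_sum_eq:
  assumes P: "P \<in> reversible_matrices \<pi>" and E: "E \<in> reversible_matrices \<pi>"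
    and orth: "P - E \<in> frob_orthogonal_comp \<pi> invariants"
    and g: "\<And>k x y. k < m \<Longrightarrow> g (s k x) (s k y) = g y x"
  shows "(\<Sum>x\<in>UNIV. \<Sum>y\<in>UNIV. pmf \<pi> x * (P $ x $ y * g x y))
    = (\<Sum>x\<in>UNIV. \<Sum>y\<in>UNIV. pmf \<pi> x * (E $ x $ y * g x y))"
proof -
  let ?F = "\<lambda>g. \<Sum>x\<in>UNIV. \<Sum>y\<in>UNIV. pmf \<pi> x * ((P - E) $ x $ y * g x y)"
  have "pmf \<pi> x * (P - E) $ x $ y = pmf \<pi> y * (P - E) $ y $ x" for x y
    using P E by (simp add: reversible_iff right_diff_distrib)
  then have "pmf \<pi> x * ((P - E) $ x $ y * g y x) = pmf \<pi> y * ((P - E) $ y $ x * g y x)" for x y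
    by (metis mult.assoc)
  then have "?F (\<lambda>x y. g y x) = (\<Sum>x\<in>UNIV. \<Sum>y\<in>UNIV. pmf \<pi> y * ((P - E) $ y $ x * g y x))"
    by (intro sum.cong refl)
  also have "\<dots> = ?F g"
    by (rule sum.swap)
  finally have "?F (\<lambda>x y. g y x) = ?F g" .
  moreover have "?F (\<lambda>x y. g x y + g y x) = ?F g + ?F (\<lambda>x y. g y x)"
    by (simp only: distrib_left sum.distrib)
  moreover have "?F (\<lambda>x y. g x y + g y x) = 0"
    by (rule orth_invariants_sum_eq_0[OF orth]) (simp add: g)
  ultimately have "?F g = 0"
    by simp
  then show ?thesis
    by (simp add: left_diff_distrib right_diff_distrib sum_subtractf)
qed

text \<open>For nonnegative entries, vanishing on \<open>Z\<close> means zero pairing with the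
  indicator of \<open>Z\<close>. Applied to the zero sets of \<open>E\<close> and \<open>N\<close>,
  this decides where divergences are finite.\<close>

lemma projection_support:
  assumes P: "P \<in> reversible_matrices \<pi>" and E: "E \<in> reversible_matrices \<pi>"
    and orth: "P - E \<in> frob_orthogonal_comp \<pi> invariants"
    and Z: "\<And>k x y. k < m \<Longrightarrow> Z (s k x) (s k y) \<longleftrightarrow> Z y x"
  shows "(\<forall>x y. Z x y \<longrightarrow> P $ x $ y = 0) \<longleftrightarrow> (\<forall>x y. Z x y \<longrightarrow> E $ x $ y = 0)"
proof -
  have "(\<forall>x y. Z x y \<longrightarrow> M $ x $ y = 0) \<longleftrightarrow>
      (\<Sum>x\<in>UNIV. \<Sum>y\<in>UNIV. pmf \<pi> x * (M $ x $ y * of_bool (Z x y))) = 0"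
    if "M \<in> reversible_matrices \<pi>" for M
    using that by (auto simp: sum_nonneg_eq_0_iff sum_nonneg reversible_iff)
  note this[OF P] this[OF E]
  moreover have "(\<Sum>x\<in>UNIV. \<Sum>y\<in>UNIV. pmf \<pi> x * (P $ x $ y * of_bool (Z x y)))
    = (\<Sum>x\<in>UNIV. \<Sum>y\<in>UNIV. pmf \<pi> x * (E $ x $ y * of_bool (Z x y)))"
    by (rule projection_sum_eq[OF P E orth]) (simp add: Z)
  ultimately show ?thesis
    by simp
qed

text \<open>For positive \<open>a\<close> this is \<open>ln t \<le> t - 1\<close> at
  \<open>t = b / a\<close>, with equality only at \<open>t = 1\<close>.\<close>

lemma Gibbs_pointwise:
  fixes a b :: real
  assumes "0 \<le> a" "0 \<le> b" "b = 0 \<Longrightarrow> a = 0"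
  shows "0 \<le> a * ln (a / b) - a + b" "a * ln (a / b) - a + b = 0 \<longleftrightarrow> a = b"
proof -
  have "0 \<le> a * ln (a / b) - a + b \<and> (a * ln (a / b) - a + b = 0 \<longleftrightarrow> a = b)"
  proof (cases "a = 0")
    case False
    then have pos: "a > 0" "b > 0"
      using assms by (auto simp: less_le)
    then have eq: "a * ln (a / b) - a + b = a * ((b / a - 1) - ln (b / a))"
      by (simp add: ln_div field_simps)
    have le: "ln (b / a) \<le> b / a - 1"
      using pos by (simp add: ln_le_minus_one)
    have "a = b" if "b / a - 1 - ln (b / a) = 0"
      using ln_eq_minus_one[of "b / a"] that pos by simp
    with le pos show ?thesis
      unfolding eq by (auto simp del: diff_divide_eq_iff)
  qed (use assms in auto)
  then show "0 \<le> a * ln (a / b) - a + b" "a * ln (a / b) - a + b = 0 \<longleftrightarrow> a = b"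
    by auto
qed

text \<open>Strictness against every other feasible matrix yields minimality and uniqueness at
  once.\<close>

lemma KL_projection_strict:
  assumes P: "P \<in> reversible_matrices \<pi>" and E: "E \<in> reversible_matrices \<pi>" "E \<in> invariants"
    and orth: "P - E \<in> frob_orthogonal_comp \<pi> invariants"
    and N: "N \<in> (\<Inter>k<m. Q_reversible_matrices \<pi> (Q k))" and m: "m \<ge> 1" and "N \<noteq> E"
  shows "KL_rate \<pi> P E < KL_rate \<pi> P N"
proof -
  have E_s: "E $ s k x $ s k y = E $ x $ y" if "k < m" for k x y
    using E(2) that by (simp add: in_invariants_iff)
  have E_sym: "pmf \<pi> x * E $ x $ y = pmf \<pi> y * E $ y $ x" for x y
    using E(1) by (simp add: reversible_iff)
  have N_s: "pmf \<pi> y * N $ y $ x = pmf \<pi> x * N $ s k x $ s k y" if "k < m" for k x y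
    using N that Q_reversible_iff[OF that] by auto
  \<comment> \<open>The intersection over an empty index set would be all matrices;
    \<open>m \<ge> 1\<close> supplies index 0.\<close>
  have "N \<in> stationary_matrices \<pi>"
    using N m Q_reversible_iff[of 0] by force
  then have N_nonneg: "0 \<le> N $ x $ y" and N_row: "(\<Sum>y\<in>UNIV. N $ x $ y) = 1" for x y
    by (auto simp: stationary_matrices_def transition_matrices_def)
  have nonneg: "0 \<le> E $ x $ y" "0 \<le> P $ x $ y" and E_row: "(\<Sum>y\<in>UNIV. E $ x $ y) = 1" for x y
    using E P by (auto simp: reversible_iff)
  have E0: "E $ x $ y = 0 \<longleftrightarrow> E $ y $ x = 0" for x y
    using E_sym[of x y] by (metis mult_eq_0_iff pi_neq_0)
  have "(\<forall>x y. E $ x $ y = 0 \<longrightarrow> P $ x $ y = 0) \<longleftrightarrow> (\<forall>x y. E $ x $ y = 0 \<longrightarrow> E $ x $ y = 0)"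
    by (rule projection_support[OF P E(1) orth]) (simp add: E_s E0)
  then have PE: "E $ x $ y = 0 \<Longrightarrow> P $ x $ y = 0" for x y
    by blast
  then have KL_PE: "KL_rate \<pi> P E
      = ereal (\<Sum>x\<in>UNIV. \<Sum>y\<in>UNIV. pmf \<pi> x * (P $ x $ y * ln (P $ x $ y / E $ x $ y)))"
    by (rule KL_rate_eq)
  show ?thesis
  proof (cases "\<forall>x y. N $ x $ y = 0 \<longrightarrow> P $ x $ y = 0")
    case False
    then show ?thesis
      using KL_rate_infinite[of N _ _ P] KL_PE by auto
  next
    case PN: True
    have "N $ s k x $ s k y = 0 \<longleftrightarrow> N $ y $ x = 0" if "k < m" for k x y
      using N_s[OF that, where x = x and y = y] by (metis mult_eq_0_iff pi_neq_0)
    then have "(\<forall>x y. N $ x $ y = 0 \<longrightarrow> P $ x $ y = 0) \<longleftrightarrow> (\<forall>x y. N $ x $ y = 0 \<longrightarrow> E $ x $ y = 0)"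
      by (rule projection_support[OF P E(1) orth])
    with PN have EN: "N $ x $ y = 0 \<Longrightarrow> E $ x $ y = 0" for x y
      by blast
    let ?g = "\<lambda>x y. ln (E $ x $ y / N $ x $ y)"
    \<comment> \<open>Detailed balance of \<open>E\<close> and the twisted balance of
      \<open>N\<close> carry the same weights, which cancel in the quotient; this is the symmetry
      that \<open>projection_sum_eq\<close> asks of \<open>?g\<close>.\<close>
    have "E $ s k x $ s k y / N $ s k x $ s k y = E $ y $ x / N $ y $ x" if "k < m" for k x y
    proof -
      have "E $ s k x $ s k y / N $ s k x $ s k y
          = (pmf \<pi> x * E $ s k x $ s k y) / (pmf \<pi> x * N $ s k x $ s k y)"
        by simp
      also have "\<dots> = (pmf \<pi> y * E $ y $ x) / (pmf \<pi> y * N $ y $ x)"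
        using N_s[OF that, where x = x and y = y] E_sym[of x y] E_s[OF that, of x y] by simp
      finally show ?thesis
        by simp
    qed
    then have sum_g: "(\<Sum>x\<in>UNIV. \<Sum>y\<in>UNIV. pmf \<pi> x * (P $ x $ y * ?g x y))
        = (\<Sum>x\<in>UNIV. \<Sum>y\<in>UNIV. pmf \<pi> x * (E $ x $ y * ?g x y))"
      by (intro projection_sum_eq[OF P E(1) orth]) simp
    \<comment> \<open>The added \<open>- E + N\<close> sums to 0 over each row and makes every
      summand nonnegative.\<close>
    let ?G = "\<lambda>x y. E $ x $ y * ?g x y - E $ x $ y + N $ x $ y"
    have G: "0 \<le> ?G x y" "?G x y = 0 \<longleftrightarrow> E $ x $ y = N $ x $ y" for x y
      by (rule Gibbs_pointwise; use nonneg N_nonneg EN in simp)+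
    have "(\<Sum>y\<in>UNIV. pmf \<pi> x * ?G x y) = (\<Sum>y\<in>UNIV. pmf \<pi> x * (E $ x $ y * ?g x y))" for x
      by (simp add: sum.distrib sum_subtractf E_row N_row flip: sum_distrib_left)
    then have KL_EN: "(\<Sum>x\<in>UNIV. \<Sum>y\<in>UNIV. pmf \<pi> x * (E $ x $ y * ?g x y))
        = (\<Sum>x\<in>UNIV. \<Sum>y\<in>UNIV. pmf \<pi> x * ?G x y)"
      by simp
    have nn: "0 \<le> pmf \<pi> x * ?G x y" for x y
      using G(1)[of x y] by (intro mult_nonneg_nonneg) auto
    have nonzero: "(\<Sum>x\<in>UNIV. \<Sum>y\<in>UNIV. pmf \<pi> x * ?G x y) \<noteq> 0"
    proof
      assume "(\<Sum>x\<in>UNIV. \<Sum>y\<in>UNIV. pmf \<pi> x * ?G x y) = 0"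
      then have "pmf \<pi> x * ?G x y = 0" for x y
        using nn by (simp add: sum_nonneg_eq_0_iff sum_nonneg)
      then have "?G x y = 0" for x y
        by (metis mult_eq_0_iff pi_neq_0)
      then have "E = N"
        unfolding G(2) by (simp add: vec_eq_iff)
      with \<open>N \<noteq> E\<close> show False
        by simp
    qed
    have pos: "0 < (\<Sum>x\<in>UNIV. \<Sum>y\<in>UNIV. pmf \<pi> x * ?G x y)"
      using nonzero by (intro order.not_eq_order_implies_strict sum_nonneg nn) metis
    have "P $ x $ y * ln (P $ x $ y / N $ x $ y)
        = P $ x $ y * ln (P $ x $ y / E $ x $ y) + P $ x $ y * ?g x y" for x y
    proof (cases "P $ x $ y = 0")
      case False
      then have "P $ x $ y > 0" "E $ x $ y > 0" "N $ x $ y > 0"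
        using PE[of x y] PN nonneg[of x y] N_nonneg[of x y] by (auto simp: less_le)
      then show ?thesis
        by (simp add: ln_div algebra_simps)
    qed simp
    then have split: "(\<Sum>x\<in>UNIV. \<Sum>y\<in>UNIV. pmf \<pi> x * (P $ x $ y * ln (P $ x $ y / N $ x $ y)))
      = (\<Sum>x\<in>UNIV. \<Sum>y\<in>UNIV. pmf \<pi> x * (P $ x $ y * ln (P $ x $ y / E $ x $ y)))
        + (\<Sum>x\<in>UNIV. \<Sum>y\<in>UNIV. pmf \<pi> x * (P $ x $ y * ?g x y))"
      by (simp only: distrib_left sum.distrib)
    have KL_PN: "KL_rate \<pi> P N
        = ereal (\<Sum>x\<in>UNIV. \<Sum>y\<in>UNIV. pmf \<pi> x * (P $ x $ y * ln (P $ x $ y / N $ x $ y)))"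
      by (rule KL_rate_eq) (use PN in blast)
    show ?thesis
      unfolding KL_PE KL_PN less_ereal.simps split sum_g KL_EN using pos
      by (simp only: less_add_same_cancel1)
  qed
qed

lemma is_KL_projection_iff:
  assumes P: "P \<in> reversible_matrices \<pi>" and E: "E \<in> reversible_matrices \<pi>" "E \<in> invariants"
    and orth: "P - E \<in> frob_orthogonal_comp \<pi> invariants" and m: "m \<ge> 1"
  shows "is_KL_projection \<pi> m Q P R \<longleftrightarrow> R = E"
proof -
  note strict = KL_projection_strict[OF P E orth _ m]
  show ?thesis
    using strict projection_in_Q_reversible[OF E]
    unfolding is_KL_projection_def is_arg_min_def by (metis less_irrefl less_asym)
qed

section \<open>The rate of convergence\<close>

text \<open>Reversibility has to persist, since \<open>Q_average\<close> is identified with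
  \<open>proj\<close> on reversible matrices.\<close>

lemma avg_seq_reversible:
  assumes "P \<in> reversible_matrices \<pi>" "m \<ge> 1"
  shows "avg_seq \<pi> m Q P n \<in> reversible_matrices \<pi>"
  using assms by (induction n) (auto simp: Q_average_eq_proj proj_reversible)

lemma avg_seq_block:
  assumes P: "P \<in> reversible_matrices \<pi>" and "m \<ge> 1"
  shows "avg_seq \<pi> m Q P (m * Suc n) = fold proj [0..<m] (avg_seq \<pi> m Q P (m * n))"
proof -
  \<comment> \<open>The restriction \<open>j \<le> m\<close> keeps the index of each new step below
    \<open>m\<close>, where \<open>(m * n + j) mod m\<close> is \<open>j\<close>.\<close>
  have "avg_seq \<pi> m Q P (m * n + j) = fold proj [0..<j] (avg_seq \<pi> m Q P (m * n))" if "j \<le> m" for j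
    using that
  proof (induction j)
    case (Suc j)
    have "avg_seq \<pi> m Q P (m * n + Suc j) = proj j (avg_seq \<pi> m Q P (m * n + j))"
      using Q_average_eq_proj[OF avg_seq_reversible[OF assms]] Suc.prems by simp
    with Suc show ?case
      by simp
  qed simp
  from this[of m] show ?thesis
    by (simp add: add.commute)
qed

lemma fold_proj_invariant:
  assumes "E \<in> invariants" "set ks \<subseteq> {..<m}"
  shows "fold proj ks (M - E) = fold proj ks M - E"
proof -
  have "proj k E = E" if "k < m" for k
    using assms(1) that by (simp add: vec_eq_iff proj_def Q_conj in_invariants_iff)
  then show ?thesis
    using assms(2) by (induction ks arbitrary: M) (simp_all add: linear_diff[OF linear_proj])
qed

text \<open>Each \<open>proj k\<close> changes its argument orthogonally to a space containing
  \<open>invariants\<close>, so the contraction can be applied again to the next block.\<close>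

lemma fold_proj_orth:
  assumes "M \<in> frob_orthogonal_comp \<pi> invariants" "set ks \<subseteq> {..<m}"
  shows "fold proj ks M \<in> frob_orthogonal_comp \<pi> invariants"
  using assms
proof (induction ks arbitrary: M)
  case (Cons k ks)
  have "M - proj k M \<in> frob_orthogonal_comp \<pi> invariants"
    using proj_orth[of k M] Cons.prems(2) by (auto simp: frob_orthogonal_comp_def invariants_def)
  then have "proj k M \<in> frob_orthogonal_comp \<pi> invariants"
    using subspace_diff[OF subspace_frob_orthogonal_comp Cons.prems(1)] by fastforce
  with Cons show ?case
    by simp
qed simp

lemma fold_proj_contraction:
  assumes "M \<in> frob_orthogonal_comp \<pi> invariants" and m: "m \<ge> 1"
  shows "frob_norm \<pi> (fold proj [0..<m] M) \<le> rate \<pi> m Q * frob_norm \<pi> M"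
proof -
  have "(frob_norm \<pi> (fold proj [0..<m] M))\<^sup>2
      \<le> (1 - (\<Prod>k\<in>{0..<m - 1}. 1 - (angle_coeff \<pi> m Q k)\<^sup>2)) * (frob_norm \<pi> M)\<^sup>2"
    unfolding angle_coeff_def using assms
    by (intro alternating_projections_bound full subspace_Q_invariant linear_proj proj_in proj_orth)
      (simp_all add: invariants_def atLeast0LessThan)
  then have "sqrt ((frob_norm \<pi> (fold proj [0..<m] M))\<^sup>2)
      \<le> sqrt ((1 - (\<Prod>k\<in>{0..<m - 1}. 1 - (angle_coeff \<pi> m Q k)\<^sup>2)) * (frob_norm \<pi> M)\<^sup>2)"
    by (rule real_sqrt_le_mono)
  then show ?thesis
    by (simp add: rate_def real_sqrt_mult frob_norm_nonneg atLeast0LessThan)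
qed

lemma rate_nonneg: "0 \<le> rate \<pi> m Q"
proof -
  have "0 \<le> angle_coeff \<pi> m Q i" "angle_coeff \<pi> m Q i \<le> 1" if "i < m - 1" for i
    unfolding angle_coeff_def using that
    by (auto intro!: cos_angle_nonneg cos_angle_le_1 subspace_Inter subspace_Q_invariant)
  then have "(\<Prod>i<m - 1. 1 - (angle_coeff \<pi> m Q i)\<^sup>2) \<le> 1"
    by (intro prod_le_1) (auto simp: power_le_one)
  then show ?thesis
    by (simp add: rate_def)
qed

lemma avg_seq_bound:
  assumes P: "P \<in> reversible_matrices \<pi>" and E: "E \<in> invariants"
    and orth: "P - E \<in> frob_orthogonal_comp \<pi> invariants" and m: "m \<ge> 1"
  shows "frob_norm \<pi> (avg_seq \<pi> m Q P (m * n) - E) \<le> rate \<pi> m Q ^ n * frob_norm \<pi> P"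
proof -
  \<comment> \<open>Orthogonality is carried through the induction because the contraction holds on
    the complement of \<open>invariants\<close>.\<close>
  have "avg_seq \<pi> m Q P (m * n) - E \<in> frob_orthogonal_comp \<pi> invariants \<and>
    frob_norm \<pi> (avg_seq \<pi> m Q P (m * n) - E) \<le> rate \<pi> m Q ^ n * frob_norm \<pi> P"
  proof (induction n)
    case 0
    have "frob_inner \<pi> (P - E) E = 0"
      using orth E by (rule frob_orthogonal_compD)
    then have "(frob_norm \<pi> P)\<^sup>2 = (frob_norm \<pi> (P - E))\<^sup>2 + (frob_norm \<pi> E)\<^sup>2"
      using frob_norm_Pythagoras[of \<pi> "P - E" E] by simp
    then have "(frob_norm \<pi> (P - E))\<^sup>2 \<le> (frob_norm \<pi> P)\<^sup>2"
      by simp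
    then have "frob_norm \<pi> (P - E) \<le> frob_norm \<pi> P"
      by (rule power2_le_imp_le) (rule frob_norm_nonneg)
    with orth show ?case
      by simp
  next
    case (Suc n)
    let ?x = "avg_seq \<pi> m Q P (m * n) - E"
    have step: "avg_seq \<pi> m Q P (m * Suc n) - E = fold proj [0..<m] ?x"
      unfolding avg_seq_block[OF P m] by (rule fold_proj_invariant[OF E, symmetric]) auto
    have "frob_norm \<pi> (fold proj [0..<m] ?x) \<le> rate \<pi> m Q * frob_norm \<pi> ?x"
      using Suc m by (blast intro: fold_proj_contraction)
    also have "\<dots> \<le> rate \<pi> m Q * (rate \<pi> m Q ^ n * frob_norm \<pi> P)"
      using Suc by (intro mult_left_mono rate_nonneg) simp
    finally show ?case
      unfolding step using fold_proj_orth[of ?x "[0..<m]"] Suc by (simp add: mult.assoc subset_iff)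
  qed
  then show ?thesis ..
qed

end

theorem corollary4p1:
  fixes \<pi> :: "'a::finite pmf"
    and m :: nat
    and P :: "real^'a^'a"
    and Q :: "nat \<Rightarrow> real^'a^'a"
  assumes "set_pmf \<pi> = UNIV"
    and "m \<ge> 1"
    and "P \<in> reversible_matrices \<pi>"
    and "\<And>k. k < m \<Longrightarrow> Q k \<in> isometric_involutions \<pi> \<inter> transition_matrices"
  shows "(\<exists>!R. is_KL_projection \<pi> m Q P R) \<and>
         (\<forall>n. frob_norm \<pi> (avg_seq \<pi> m Q P (m * n) - avg_limit \<pi> m Q P)
                \<le> rate \<pi> m Q ^ n * frob_norm \<pi> P)"
proof -
  have "\<exists>f. (\<forall>x y. Q k $ x $ y = of_bool (y = f x)) \<and> (\<forall>x. f (f x) = x) \<and>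
      (\<forall>x. pmf \<pi> (f x) = pmf \<pi> x)" if "k < m" for k
    using stochastic_involution_permutation[OF assms(1) assms(4)[OF that]] by metis
  then obtain s where s: "\<And>k. k < m \<Longrightarrow> (\<forall>x y. Q k $ x $ y = of_bool (y = s k x)) \<and>
      (\<forall>x. s k (s k x) = x) \<and> (\<forall>x. pmf \<pi> (s k x) = pmf \<pi> x)"
    by metis
  interpret stochastic_involutions \<pi> m Q s
    by standard (use assms(1) s in auto)
  have "subspace invariants"
    unfolding invariants_def by (intro subspace_Inter) (auto intro: subspace_Q_invariant)
  then obtain E where E: "E \<in> invariants" and orth: "P - E \<in> frob_orthogonal_comp \<pi> invariants"
    by (rule frob_projection_exists)
  have "E \<in> reversible_matrices \<pi>"
    using assms(3) E orth by (rule projection_reversible)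
  then have KL: "is_KL_projection \<pi> m Q P R \<longleftrightarrow> R = E" for R
    using is_KL_projection_iff[OF assms(3) _ E orth assms(2)] by simp
  \<comment> \<open>Since exactly \<open>E\<close> is a minimizer, the definite description denotes
    it.\<close>
  then have "avg_limit \<pi> m Q P = E"
    by (simp add: avg_limit_def)
  with KL avg_seq_bound[OF assms(3) E orth assms(2)] show ?thesis
    by simp
qed

end
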